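(* Let $\Lambda$ be a sequence in $\mathbb{D}$ satisfying the Blaschke condition $\sum_{\lambda\in\Lambda}(1-|\lambda|)<\infty$. The following are equivalent: (a) $N|\Lambda\subset l_{\mathrm{Ya}}$; (b) $N^+|\Lambda\subset l_{\mathrm{Ya}}$; (c) $\mu_\Lambda:=\sum_{\lambda\in\Lambda}(1-|\lambda|)\delta_\lambda$ has bounded balayage, i.e. $\displaystyle\sup_{\zeta\in\partial\mathbb{D}}\sum_{\lambda\in\Lambda}(1-|\lambda|)P_\lambda(\zeta)<\infty$.
   Context: $\mathbb{D}$ is the open unit disc. A sequence $\Lambda\subset\mathbb{D}$ means a discrete sequence of (distinct) points. $l_{\mathrm{Ya}}=\{(a_\lambda)_{\lambda\in\Lambda}:\sum_{\lambda\in\Lambda}(1-|\lambda|)\log^+|a_\lambda|<\infty\}$. $P_z(\zeta)=\frac{1-|z|^2}{|\zeta-z|^2}$ is the Poisson kernel and $\delta_\lambda$ is the Dirac measure at $\lambda$. The Nevanlinna class is $N=\{f\in\mathrm{Hol}(\mathbb{D}):\lim_{r\to1}\frac1{2\pi}\int_0^{2\pi}\log^+|f(re^{i\theta})|\,d\theta<\infty\}$, and the Smirnov class $N^+$ is the set of $f\in N$ with $\lim_{r\to1}\frac1{2\pi}\int_0^{2\pi}\log^+|f(re^{i\theta})|\,d\theta=\frac1{2\pi}\int_0^{2\pi}\log^+|f(e^{i\theta})|\,d\theta$ (non-tangential boundary values). For a space $X$ of holomorphic functions on $\mathbb{D}$, $X|\Lambda=\{(f(\lambda))_{\lambda\in\Lambda}:f\in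 X\}$. *)

theory Defs
  imports "HOL-Analysis.Analysis"
begin

definition log_plus :: "real \<Rightarrow> real" where
  "log_plus x = ln (max 1 x)"

definition log_mean :: "(complex \<Rightarrow> complex) \<Rightarrow> real \<Rightarrow> real" where
  "log_mean f r = 1 / (2 * pi) *
     integral {0..2 * pi} (\<lambda>\<theta>. log_plus (cmod (f (of_real r * cis \<theta>))))"

text \<open>
  Holomorphic functions on the disc are represented by functions on the whole plane; only
  their values on the disc matter.
\<close>

definition nevanlinna :: "(complex \<Rightarrow> complex) set" where
  "nevanlinna = {f. f holomorphic_on ball 0 1 \<and> (\<exists>L. (log_mean f \<longlongrightarrow> L) (at_left 1))}"

definition stolz :: "complex \<Rightarrow> real \<Rightarrow> complex set" where
  "stolz \<zeta> \<alpha> = {z \<in> ball 0 1. cmod (z - \<zeta>) < \<alpha> * (1 - cmod z)}"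

text \<open>
  The filter of non-tangential approach to a boundary point: a limit along it is a limit
  within every Stolz angle. The angles of aperture at most 1 are empty and are left out.
\<close>

definition nontangential :: "complex \<Rightarrow> complex filter" where
  "nontangential \<zeta> = (SUP \<alpha>\<in>{1<..}. at \<zeta> within stolz \<zeta> \<alpha>)"

lemma tendsto_nontangential_iff:
  "(f \<longlongrightarrow> l) (nontangential \<zeta>) \<longleftrightarrow> (\<forall>\<alpha>>1. (f \<longlongrightarrow> l) (at \<zeta> within stolz \<zeta> \<alpha>))"
  by (auto simp: nontangential_def filterlim_def filtermap_SUP SUP_le_iff)

text \<open>
  The value is unspecified where the non-tangential limit does not exist. For a function of
  the Nevanlinna class these points form a null set, by Fatou's theorem, so they do not
  affect the integral below.
\<close>

definition boundary_value :: "(complex \<Rightarrow> complex) \<Rightarrow> complex \<Rightarrow> complex" where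
  "boundary_value f \<zeta> = Lim (nontangential \<zeta>) f"

text \<open>
  Integrability is required explicitly, because the integral of a non-integrable function
  is 0 by convention.
\<close>

definition smirnov :: "(complex \<Rightarrow> complex) set" where
  "smirnov = {f \<in> nevanlinna.
     (\<lambda>\<theta>. log_plus (cmod (boundary_value f (cis \<theta>)))) integrable_on {0..2 * pi} \<and>
     (log_mean f \<longlongrightarrow>
        1 / (2 * pi) * integral {0..2 * pi} (\<lambda>\<theta>. log_plus (cmod (boundary_value f (cis \<theta>)))))
       (at_left 1)}"

text \<open>
  A family indexed by \<open>\<Lambda>\<close> is a function that is extensional on \<open>\<Lambda>\<close>.
\<close>

definition trace_space :: "(complex \<Rightarrow> complex) set \<Rightarrow> complex set \<Rightarrow> (complex \<Rightarrow> complex) set"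
  where "trace_space X \<Lambda> = (\<lambda>f. restrict f \<Lambda>) ` X"

definition l_Ya :: "complex set \<Rightarrow> (complex \<Rightarrow> complex) set" where
  "l_Ya \<Lambda> = {a \<in> extensional \<Lambda>. (\<lambda>z. (1 - cmod z) * log_plus (cmod (a z))) summable_on \<Lambda>}"

definition poisson_kernel :: "complex \<Rightarrow> complex \<Rightarrow> real" where
  "poisson_kernel z \<zeta> = (1 - (cmod z)\<^sup>2) / (cmod (\<zeta> - z))\<^sup>2"

text \<open>The Borel measure with mass \<open>1 - \<bar>z\<bar>\<close> at each point \<open>z\<close> of \<open>\<Lambda>\<close>.\<close>

definition mu_seq :: "complex set \<Rightarrow> complex measure" where
  "mu_seq \<Lambda> = distr (point_measure \<Lambda> (\<lambda>z. ennreal (1 - cmod z))) borel (\<lambda>z. z)"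

definition balayage :: "complex measure \<Rightarrow> complex \<Rightarrow> ennreal" where
  "balayage \<mu> \<zeta> = (\<integral>\<^sup>+ z. ennreal (poisson_kernel z \<zeta>) \<partial>\<mu>)"

definition bounded_balayage :: "complex measure \<Rightarrow> bool" where
  "bounded_balayage \<mu> \<longleftrightarrow> (SUP \<zeta>\<in>sphere 0 1. balayage \<mu> \<zeta>) < \<infinity>"

lemma nn_integral_count_space_eq_infsum:
  fixes f :: "'a \<Rightarrow> ennreal"
  assumes "countable A"
  shows "(\<integral>\<^sup>+ x. f x \<partial>count_space A) = (\<Sum>\<^sub>\<infinity>x\<in>A. f x)"
proof (cases "A = {}")
  case False
  define F where "F n = from_nat_into A ` {..n}" for n
  have F: "finite (F n)" "F n \<subseteq> A" for n
    using from_nat_into[OF False] by (auto simp: F_def)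
  have fin: "(\<integral>\<^sup>+ x. f x * indicator G x \<partial>count_space A) = sum f G" if "finite G" "G \<subseteq> A" for G
  proof -
    have "(\<integral>\<^sup>+ x. f x * indicator G x \<partial>count_space A) = (\<Sum>x\<in>G. f x * indicator G x)"
      using that by (intro nn_integral_count_space') (auto simp: indicator_def)
    also have "\<dots> = sum f G"
      by (intro sum.cong) auto
    finally show ?thesis .
  qed
  have inf: "(\<Sum>\<^sub>\<infinity>x\<in>A. f x) = (SUP G\<in>{G. finite G \<and> G \<subseteq> A}. sum f G)"
    by (rule nonneg_infsum_complete) auto
  have sup: "(SUP n. f x * indicator (F n) x) = f x" if "x \<in> A" for x
  proof (rule antisym)
    show "(SUP n. f x * indicator (F n) x) \<le> f x"
      by (intro SUP_least) (auto simp: indicator_def)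
    have "x \<in> F (to_nat_on A x)"
      using that assms by (auto simp: F_def intro!: image_eqI[of _ _ "to_nat_on A x"])
    then show "f x \<le> (SUP n. f x * indicator (F n) x)"
      by (intro SUP_upper2[of "to_nat_on A x"]) auto
  qed
  have "(\<integral>\<^sup>+ x. f x \<partial>count_space A) = (\<integral>\<^sup>+ x. (SUP n. f x * indicator (F n) x) \<partial>count_space A)"
    by (intro nn_integral_cong) (simp add: sup)
  also have "\<dots> = (SUP n. \<integral>\<^sup>+ x. f x * indicator (F n) x \<partial>count_space A)"
    by (intro nn_integral_monotone_convergence_SUP)
       (auto simp: incseq_def le_fun_def indicator_def F_def)
  also have "\<dots> \<le> (SUP G\<in>{G. finite G \<and> G \<subseteq> A}. sum f G)"
    using F by (intro SUP_least) (simp add: fin, intro SUP_upper, auto)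
  finally have "(\<integral>\<^sup>+ x. f x \<partial>count_space A) \<le> (\<Sum>\<^sub>\<infinity>x\<in>A. f x)"
    by (simp add: inf)
  moreover have "(\<Sum>\<^sub>\<infinity>x\<in>A. f x) \<le> (\<integral>\<^sup>+ x. f x \<partial>count_space A)"
    unfolding inf
  proof (intro SUP_least)
    fix G assume "G \<in> {G. finite G \<and> G \<subseteq> A}"
    then have "sum f G = (\<integral>\<^sup>+ x. f x * indicator G x \<partial>count_space A)"
      by (simp add: fin)
    also have "\<dots> \<le> (\<integral>\<^sup>+ x. f x \<partial>count_space A)"
      by (intro nn_integral_mono) (auto simp: indicator_def)
    finally show "sum f G \<le> (\<integral>\<^sup>+ x. f x \<partial>count_space A)" .
  qed
  ultimately show ?thesis by (rule antisym)
qed (simp add: nn_integral_empty)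

lemma balayage_mu_seq:
  assumes "\<Lambda> \<subseteq> ball 0 1" "(\<lambda>z. 1 - cmod z) summable_on \<Lambda>"
  shows "balayage (mu_seq \<Lambda>) \<zeta> = (\<Sum>\<^sub>\<infinity>z\<in>\<Lambda>. ennreal ((1 - cmod z) * poisson_kernel z \<zeta>))"
proof -
  have m: "(\<lambda>z. ennreal (poisson_kernel z \<zeta>)) \<in> borel_measurable borel"
    unfolding poisson_kernel_def by measurable
  have "balayage (mu_seq \<Lambda>) \<zeta>
      = (\<integral>\<^sup>+ z. ennreal (poisson_kernel z \<zeta>) \<partial>point_measure \<Lambda> (\<lambda>z. ennreal (1 - cmod z)))"
    unfolding balayage_def mu_seq_def
    by (rule nn_integral_distr) (use m in \<open>auto simp: point_measure_def\<close>)
  also have "\<dots> = (\<integral>\<^sup>+ z. ennreal (1 - cmod z) * ennreal (poisson_kernel z \<zeta>) \<partial>count_space \<Lambda>)"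
    unfolding point_measure_def by (rule nn_integral_density) auto
  also have "\<dots> = (\<integral>\<^sup>+ z. ennreal ((1 - cmod z) * poisson_kernel z \<zeta>) \<partial>count_space \<Lambda>)"
    using assms by (intro nn_integral_cong) (auto simp: ennreal_mult' subset_iff)
  also have "\<dots> = (\<Sum>\<^sub>\<infinity>z\<in>\<Lambda>. ennreal ((1 - cmod z) * poisson_kernel z \<zeta>))"
  proof (rule nn_integral_count_space_eq_infsum)
    have "countable {z \<in> \<Lambda>. 1 - cmod z \<noteq> 0}"
      by (rule summable_countable_real[OF assms(2)])
    also have "{z \<in> \<Lambda>. 1 - cmod z \<noteq> 0} = \<Lambda>"
      using assms(1) by (auto simp: subset_iff)
    finally show "countable \<Lambda>" .
  qed
  finally show ?thesis .
qed

lemma bounded_balayage_mu_seq_iff: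
  assumes "\<Lambda> \<subseteq> ball 0 1" "(\<lambda>z. 1 - cmod z) summable_on \<Lambda>"
  shows "bounded_balayage (mu_seq \<Lambda>) \<longleftrightarrow>
    (SUP \<zeta>\<in>sphere 0 1. \<Sum>\<^sub>\<infinity>z\<in>\<Lambda>. ennreal ((1 - cmod z) * poisson_kernel z \<zeta>)) < \<infinity>"
  by (simp add: bounded_balayage_def balayage_mu_seq[OF assms])

end

theory Submission
  imports Defs "HOL-Complex_Analysis.Complex_Analysis"
begin

text \<open>
  A function \<open>f\<close> of the Nevanlinna class satisfies
  \<open>log\<^sup>+ \<bar>f(r\<lambda>)\<bar> \<le> P[log\<^sup>+ \<bar>f(r \<cdot>)\<bar>](\<lambda>)\<close> for \<open>r < 1\<close>. Summing this over a finite part of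
  \<open>\<Lambda>\<close> puts the balayage under the integral, and \<open>r \<rightarrow> 1\<close> gives the bound for (c) \<open>\<Longrightarrow>\<close> (a).

  If the balayage is unbounded, there are points \<open>a\<^sub>n\<close> of the disc for which the positive
  harmonic functions \<open>u\<^sub>n(z) = Re ((1 + a\<^sub>n z) / (1 - a\<^sub>n z))\<close>, normalised by \<open>u\<^sub>n(0) = 1\<close>, have
  \<open>\<Sum> (1 - \<bar>\<lambda>\<bar>) u\<^sub>n(\<lambda>) > 4\<^sup>n\<close>. Then \<open>\<Sum> 2\<^sup>-\<^sup>n u\<^sub>n = log \<bar>f\<bar>\<close> for a function \<open>f\<close> whose trace is not
  in \<open>l\<^sub>Y\<^sub>a\<close>. Passing to a subsequence with \<open>a\<^sub>n \<rightarrow> l\<close> makes \<open>f\<close> continuous on the closed disc except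
  perhaps at the point with \<open>l z = 1\<close>, so that \<open>f\<close> is in the Smirnov class by monotone convergence.
\<close>

section \<open>Elementary properties of the positive logarithm\<close>

lemma log_plus_nonneg [simp]: "log_plus x \<ge> 0"
  by (simp add: log_plus_def)

lemma continuous_on_log_plus [continuous_intros]:
  "continuous_on A f \<Longrightarrow> continuous_on A (\<lambda>x. log_plus (f x))"
  unfolding log_plus_def by (intro continuous_intros) (auto simp: max_def)

lemma tendsto_log_plus [tendsto_intros]:
  "(f \<longlongrightarrow> l) F \<Longrightarrow> ((\<lambda>x. log_plus (f x)) \<longlongrightarrow> log_plus l) F"
  unfolding log_plus_def by (intro tendsto_intros) (auto simp: max_def)

lemma log_plus_exp: "x \<ge> 0 \<Longrightarrow> log_plus (exp x) = x"
  by (simp add: log_plus_def max_def)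

lemma log_plus_le_iff: "b \<ge> 0 \<Longrightarrow> log_plus x \<le> b \<longleftrightarrow> x \<le> exp b"
proof -
  assume b: "b \<ge> 0"
  have "log_plus x \<le> b \<longleftrightarrow> max 1 x \<le> exp b"
    unfolding log_plus_def by (metis exp_gt_zero exp_le_cancel_iff exp_ln less_max_iff_disj zero_less_one)
  then show ?thesis using b by simp
qed

lemma le_exp_log_plus: "x \<le> exp (log_plus x)"
  using log_plus_le_iff[of "log_plus x" x] by simp

subsection \<open>Poisson integrals\<close>

lemma poisson_kernel_nonneg: "z \<in> ball 0 1 \<Longrightarrow> poisson_kernel z \<zeta> \<ge> 0"
  by (auto simp: poisson_kernel_def abs_square_le_1 intro!: divide_nonneg_nonneg)

lemma continuous_on_poisson_kernel [continuous_intros]: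
  assumes "z \<in> ball 0 1" "continuous_on A f" "\<And>x. x \<in> A \<Longrightarrow> cmod (f x) = 1"
  shows "continuous_on A (\<lambda>x. poisson_kernel z (f x))"
  unfolding poisson_kernel_def using assms by (intro continuous_intros) auto

lemma poisson_formula:
  fixes f :: "complex \<Rightarrow> complex"
  assumes contf: "continuous_on (cball 0 1) f" and holf: "f holomorphic_on ball 0 1"
    and z: "z \<in> ball 0 1"
  shows "((\<lambda>\<theta>. of_real (poisson_kernel z (cis \<theta>)) * f (cis \<theta>)) has_integral 2 * pi * f z) {0..2*pi}"
proof -
  \<comment> \<open>On the unit circle \<open>P\<^sub>z(u) = u (1 - \<bar>z\<bar>\<^sup>2) / ((u - z) (1 - cnj z * u))\<close>, so this is Cauchy's
    formula for \<open>q\<close>.\<close>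
  define q where "q u = f u * of_real (1 - (cmod z)\<^sup>2) / (1 - cnj z * u)" for u
  have nz: "1 - cnj z * u \<noteq> 0" if "u \<in> cball 0 1" for u
  proof
    assume "1 - cnj z * u = 0"
    then have "cmod z * cmod u = 1"
      by (metis complex_mod_cnj eq_iff_diff_eq_0 norm_mult norm_one)
    moreover have "cmod z * cmod u \<le> cmod z * 1"
      using that by (intro mult_left_mono) auto
    ultimately show False
      using z by simp
  qed
  have "continuous_on (cball 0 1) q"
    unfolding q_def by (intro continuous_intros contf) (use nz in auto)
  moreover have "q holomorphic_on ball 0 1"
    unfolding q_def by (intro holomorphic_intros holf) (use nz in auto)
  ultimately have "((\<lambda>u. q u / (u - z)) has_contour_integral 2 * of_real pi * \<i> * q z) (circlepath 0 1)"
    by (rule Cauchy_integral_circlepath) (use z in auto)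
  moreover have "q z = f z"
  proof -
    have "of_real (1 - (cmod z)\<^sup>2) = 1 - cnj z * z"
      using complex_norm_square[of z] by (simp add: mult.commute)
    then have "q z = f z * (1 - cnj z * z) / (1 - cnj z * z)"
      by (simp only: q_def)
    then show ?thesis
      using nz[of z] z by simp
  qed
  ultimately have "((\<lambda>t. q (cis t) / (cis t - z) * \<i> * cis t) has_integral 2 * of_real pi * \<i> * f z) {0..2*pi}"
    by (simp add: circlepath_def has_contour_integral_part_circlepath_iff)
  \<comment> \<open>The factor \<open>- \<i>\<close> turns the constant of Cauchy's formula into
    \<open>2 * pi\<close> and cancels the \<open>\<i>\<close> coming from the derivative of
    \<open>cis\<close>.\<close>
  from has_integral_mult_right[OF this, of "- \<i>"]
  have "((\<lambda>t. - \<i> * (q (cis t) / (cis t - z) * \<i> * cis t)) has_integral 2 * pi * f z) {0..2*pi}"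
    by (simp add: algebra_simps)
  moreover have "- \<i> * (q (cis t) / (cis t - z) * \<i> * cis t) = of_real (poisson_kernel z (cis t)) * f (cis t)" for t
  proof -
    define u where "u = cis t"
    have u: "u * cnj u = 1" "cmod u = 1"
      by (simp_all add: u_def cis_cnj cis_mult)
    have [simp]: "u \<noteq> z" using z u by auto
    have nzu: "1 - cnj z * u \<noteq> 0" using nz u by simp
    have "of_real ((cmod (u - z))\<^sup>2) = (u - z) * (cnj u - cnj z)"
      by (simp only: complex_norm_square complex_cnj_diff)
    \<comment> \<open>Multiplying by \<open>u\<close> lets \<open>u * cnj u = 1\<close> remove the
      conjugate of \<open>u\<close>, which matches the denominator of Cauchy's integrand.\<close>
    then have "u * of_real ((cmod (u - z))\<^sup>2) = (u - z) * (u * cnj u - cnj z * u)"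
      by (simp only: right_diff_distrib mult_ac)
    then have "u * of_real ((cmod (u - z))\<^sup>2) = (u - z) * (1 - cnj z * u)"
      by (simp only: u)
    then have eq: "u / ((u - z) * (1 - cnj z * u)) = 1 / of_real ((cmod (u - z))\<^sup>2)"
      using nzu by (simp add: divide_simps)
    have "- \<i> * (q u / (u - z) * \<i> * u) = f u * of_real (1 - (cmod z)\<^sup>2) * (u / ((u - z) * (1 - cnj z * u)))"
    proof -
      have "- \<i> * (c * \<i> * u) = c * u" for c
        by (simp add: complex_eq_iff algebra_simps)
      from this[of "q u / (u - z)"] show ?thesis
        by (simp add: q_def)
    qed
    then show ?thesis
      unfolding eq u_def[symmetric] poisson_kernel_def by simp
  qed
  ultimately show ?thesis by simp
qed

lemma poisson_formula_Re:
  fixes f :: "complex \<Rightarrow> complex"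
  assumes "continuous_on (cball 0 1) f" "f holomorphic_on ball 0 1" "z \<in> ball 0 1"
  shows "((\<lambda>\<theta>. poisson_kernel z (cis \<theta>) * Re (f (cis \<theta>))) has_integral 2 * pi * Re (f z)) {0..2*pi}"
  using has_integral_Re[OF poisson_formula[OF assms]] by simp

text \<open>The Poisson kernel at the origin is identically 1 on the circle.\<close>

lemma mean_value_Re:
  fixes f :: "complex \<Rightarrow> complex"
  assumes "continuous_on (cball 0 1) f" "f holomorphic_on ball 0 1"
  shows "((\<lambda>\<theta>. Re (f (cis \<theta>))) has_integral 2 * pi * Re (f 0)) {0..2*pi}"
  using poisson_formula_Re[OF assms, of 0] by (simp add: poisson_kernel_def)

section \<open>Trigonometric polynomials and Stone-Weierstrass on the circle\<close>

text \<open>On the circle these are the real trigonometric polynomials. Written as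
  \<open>Re (poly p z)\<close>, each comes with a holomorphic extension into the disc.\<close>

definition trig_polys :: "(complex \<Rightarrow> real) set" where
  "trig_polys = {h. \<exists>p. \<forall>z\<in>sphere 0 1. h z = Re (poly p z)}"

lemma trig_polys_cong: "h \<in> trig_polys \<Longrightarrow> (\<And>z. z \<in> sphere 0 1 \<Longrightarrow> h z = g z) \<Longrightarrow> g \<in> trig_polys"
  unfolding trig_polys_def by auto

lemma trig_polys_add: "h \<in> trig_polys \<Longrightarrow> g \<in> trig_polys \<Longrightarrow> (\<lambda>z. h z + g z) \<in> trig_polys"
  unfolding trig_polys_def by (auto, metis poly_add plus_complex.sel(1))

lemma trig_polys_monom: "(\<lambda>z. Re (c * z ^ k)) \<in> trig_polys"
  unfolding trig_polys_def by (auto intro!: exI[of _ "monom c k"] simp: poly_monom)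

lemma trig_polys_sum: "finite A \<Longrightarrow> (\<And>i. i \<in> A \<Longrightarrow> h i \<in> trig_polys) \<Longrightarrow> (\<lambda>z. \<Sum>i\<in>A. h i z) \<in> trig_polys"
proof (induction A rule: finite_induct)
  case empty
  then show ?case using trig_polys_monom[of 0 0] by simp
qed (simp add: trig_polys_add)

text \<open>This is the product-to-sum formula Re u Re v = Re (u v / 2) + Re (cnj u v / 2). On the
  circle \<open>cnj z\<close> is the inverse of \<open>z\<close>, so the second term has degree
  \<open>k - j\<close>; the symmetry in the two factors allows \<open>j \<le> k\<close>.\<close>

lemma trig_polys_mult_monom:
  "(\<lambda>z. Re (c * z ^ j) * Re (d * z ^ k)) \<in> trig_polys"
proof (induction j k arbitrary: c d rule: linorder_wlog)
  case (sym j k)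
  then show ?case by (subst mult.commute)
next
  case (le j k)
  have "(\<lambda>z. Re (c * d / 2 * z ^ (j + k)) + Re (cnj c * d / 2 * z ^ (k - j))) \<in> trig_polys"
    by (intro trig_polys_add trig_polys_monom)
  then show ?case
  proof (rule trig_polys_cong)
    fix z :: complex assume z: "z \<in> sphere 0 1"
    have "cnj z * z = 1"
      using z complex_norm_square[of z] by (simp add: mult.commute)
    then have "cnj z ^ j * z ^ j = 1"
      by (simp flip: power_mult_distrib)
    moreover have "z ^ k = z ^ j * z ^ (k - j)"
      using le by (simp flip: power_add)
    moreover have "cnj (c * z ^ j) * (d * (z ^ j * z ^ (k - j))) = cnj c * d * z ^ (k - j) * (cnj z ^ j * z ^ j)"
      by (simp add: mult_ac)
    ultimately have "cnj c * d / 2 * z ^ (k - j) = cnj (c * z ^ j) * (d * z ^ k) / 2"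
      by simp
    moreover have "c * d / 2 * z ^ (j + k) = c * z ^ j * (d * z ^ k) / 2"
      by (simp add: power_add)
    moreover have "Re u * Re v = Re (u * v / 2) + Re (cnj u * v / 2)" for u v
      by (simp add: field_simps)
    ultimately show "Re (c * d / 2 * z ^ (j + k)) + Re (cnj c * d / 2 * z ^ (k - j))
        = Re (c * z ^ j) * Re (d * z ^ k)"
      by (simp only:)
  qed
qed

lemma trig_polys_mult:
  assumes "h \<in> trig_polys" "g \<in> trig_polys"
  shows "(\<lambda>z. h z * g z) \<in> trig_polys"
proof -
  obtain p q where p: "\<And>z. z \<in> sphere 0 1 \<Longrightarrow> h z = Re (poly p z)"
    and q: "\<And>z. z \<in> sphere 0 1 \<Longrightarrow> g z = Re (poly q z)"
    using assms unfolding trig_polys_def by auto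
  have "(\<lambda>z. \<Sum>i\<le>degree p. \<Sum>j\<le>degree q. Re (coeff p i * z ^ i) * Re (coeff q j * z ^ j)) \<in> trig_polys"
    by (intro trig_polys_sum trig_polys_mult_monom) auto
  then show ?thesis
    by (rule trig_polys_cong) (simp only: p q poly_altdef Re_sum sum_product)
qed

interpretation trig_polys: function_ring_on trig_polys "sphere 0 1"
proof
  fix h :: "complex \<Rightarrow> real" assume "h \<in> trig_polys"
  then obtain p where "\<forall>z\<in>sphere 0 1. h z = Re (poly p z)"
    unfolding trig_polys_def by auto
  moreover have "continuous_on (sphere 0 1) (\<lambda>z. Re (poly p z))"
    by (intro continuous_intros)
  ultimately show "continuous_on (sphere 0 1) h"
    using continuous_on_cong by (metis (no_types, lifting))
next
  fix c :: real
  show "(\<lambda>_. c) \<in> trig_polys"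
    using trig_polys_monom[of "of_real c" 0] by simp
next
  fix x y :: complex assume "x \<noteq> y"
  \<comment> \<open>The two monomials are the coordinate functions Re and Im, which separate
    points.\<close>
  then have "Re (1 * x ^ 1) \<noteq> Re (1 * y ^ 1) \<or> Re (- \<i> * x ^ 1) \<noteq> Re (- \<i> * y ^ 1)"
    by (simp add: complex_eq_iff)
  then show "\<exists>f\<in>trig_polys. f x \<noteq> f y"
    using trig_polys_monom[of 1 1] trig_polys_monom[of "- \<i>" 1] by metis
qed (rule compact_sphere trig_polys_add trig_polys_mult; assumption)+

text \<open>
  The boundary values of \<open>log\<^sup>+ \<bar>g\<bar>\<close> are approximated from above by \<open>Re p\<close> for a polynomial
  \<open>p\<close>; the maximum principle for \<open>g exp(-p)\<close> then gives \<open>log\<^sup>+ \<bar>g\<bar> \<le> Re p\<close> in the disc.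
\<close>

lemma log_plus_le_poisson_integral:
  assumes contg: "continuous_on (cball 0 1) g" and holg: "g holomorphic_on ball 0 1"
    and z: "z \<in> ball 0 1"
  shows "2 * pi * log_plus (cmod (g z))
    \<le> integral {0..2*pi} (\<lambda>\<theta>. poisson_kernel z (cis \<theta>) * log_plus (cmod (g (cis \<theta>))))"
    (is "_ \<le> integral _ ?v")
proof (rule field_le_epsilon)
  fix e :: real assume e: "e > 0"
  \<comment> \<open>Chosen so that an error of \<open>2 * d\<close> on the circle, integrated
    against a kernel of total mass \<open>2 * pi\<close>, costs exactly \<open>e\<close>.\<close>
  define d where "d = e / (4 * pi)"
  have d: "d > 0" using e by (simp add: d_def)
  have contg': "continuous_on (sphere 0 1) g"
    by (rule continuous_on_subset[OF contg]) auto
  \<comment> \<open>Raising the target by \<open>d\<close> turns a two-sided approximation within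
    \<open>d\<close> into a majorant that is at most \<open>2 * d\<close> too large.\<close>
  have "continuous_on (sphere 0 1) (\<lambda>w. log_plus (cmod (g w)) + d)"
    by (intro continuous_intros contg')
  then obtain h where "h \<in> trig_polys"
    and h: "\<And>w. w \<in> sphere 0 1 \<Longrightarrow> \<bar>log_plus (cmod (g w)) + d - h w\<bar> < d"
    using trig_polys.Stone_Weierstrass_basic d by blast
  then obtain p where p: "\<And>w. w \<in> sphere 0 1 \<Longrightarrow> h w = Re (poly p w)"
    unfolding trig_polys_def by auto
  have lower: "log_plus (cmod (g w)) \<le> Re (poly p w)"
    and upper: "Re (poly p w) \<le> log_plus (cmod (g w)) + 2 * d" if "w \<in> sphere 0 1" for w
    using h[OF that] p[OF that] by linarith+
  have poly_hol: "poly p holomorphic_on ball 0 1"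
    by (auto intro!: holomorphic_intros)
  note P = poisson_formula_Re[OF continuous_on_poly[OF continuous_on_id] poly_hol z]
  note P1 = poisson_formula_Re[OF continuous_on_const holomorphic_on_const z, of 1]
  have "continuous_on {0..2*pi} ?v"
    by (intro continuous_intros z continuous_on_compose2[OF contg]) auto
  then have int_v: "(?v has_integral integral {0..2*pi} ?v) {0..2*pi}"
    using integrable_continuous_real integrable_integral by blast
  \<comment> \<open>The maximum principle only bounds \<open>cmod (g z)\<close> by
    \<open>exp (Re (poly p z))\<close>; passing to \<open>log_plus\<close> also needs a nonnegative
    exponent.\<close>
  have "0 \<le> 2 * pi * Re (poly p z)"
    using P by (rule has_integral_nonneg)
      (use lower poisson_kernel_nonneg[OF z] in \<open>auto intro!: mult_nonneg_nonneg order_trans[OF log_plus_nonneg lower]\<close>)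
  then have nonneg: "0 \<le> Re (poly p z)"
    using pi_gt_zero by (metis mult_pos_pos zero_less_numeral mult_le_cancel_left_pos mult_zero_right)
  have "cmod (g z * exp (- poly p z)) \<le> 1"
  proof (rule maximum_modulus_frontier[where f = "\<lambda>z. g z * exp (- poly p z)" and S = "cball 0 1"])
    show "(\<lambda>z. g z * exp (- poly p z)) holomorphic_on interior (cball 0 1)"
      using holg by (auto intro!: holomorphic_intros)
    show "continuous_on (closure (cball 0 1)) (\<lambda>z. g z * exp (- poly p z))"
      using contg by (auto intro!: continuous_intros)
    show "cmod (g w * exp (- poly p w)) \<le> 1" if "w \<in> frontier (cball 0 1)" for w
    proof -
      have w: "w \<in> sphere 0 1" using that by (simp add: frontier_cball)
      have "cmod (g w) \<le> exp (Re (poly p w))"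
        using le_exp_log_plus[of "cmod (g w)"] lower[OF w] by (meson exp_le_cancel_iff order_trans)
      then show ?thesis by (simp add: norm_mult) (simp add: exp_minus field_simps)
    qed
  qed (use z in auto)
  then have "cmod (g z) \<le> exp (Re (poly p z))"
    by (simp add: norm_mult) (simp add: exp_minus field_simps)
  then have "log_plus (cmod (g z)) \<le> Re (poly p z)"
    using log_plus_le_iff nonneg by blast
  then have "2 * pi * log_plus (cmod (g z)) \<le> 2 * pi * Re (poly p z)"
    by simp
  also have "\<dots> \<le> integral {0..2*pi} ?v + 2 * d * (2 * pi)"
  proof (rule has_integral_le[OF P])
    show "((\<lambda>\<theta>. ?v \<theta> + 2 * d * poisson_kernel z (cis \<theta>)) has_integral
        integral {0..2*pi} ?v + 2 * d * (2 * pi)) {0..2*pi}"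
      using has_integral_add[OF int_v has_integral_mult_right[OF P1, of "2 * d"]] by simp
    fix \<theta>
    show "poisson_kernel z (cis \<theta>) * Re (poly p (cis \<theta>)) \<le> ?v \<theta> + 2 * d * poisson_kernel z (cis \<theta>)"
      using mult_left_mono[OF upper[of "cis \<theta>"] poisson_kernel_nonneg[OF z, of "cis \<theta>"]]
      by (simp add: algebra_simps)
  qed
  also have "2 * d * (2 * pi) = e"
    by (simp add: d_def)
  finally show "2 * pi * log_plus (cmod (g z)) \<le> integral {0..2*pi} ?v + e" .
qed

subsection \<open>Traces of the Nevanlinna class\<close>

text \<open>A sum of nonnegative extended reals is the supremum of its finite partial sums. Both
  implications that use the balayage can then work with finite real sums.\<close>

lemma bounded_balayage_mu_seq_iff_finite_sums:
  assumes "\<Lambda> \<subseteq> ball 0 1" "(\<lambda>z. 1 - cmod z) summable_on \<Lambda>"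
  shows "bounded_balayage (mu_seq \<Lambda>) \<longleftrightarrow>
    (\<exists>C. \<forall>\<zeta>\<in>sphere 0 1. \<forall>F. finite F \<and> F \<subseteq> \<Lambda> \<longrightarrow> (\<Sum>z\<in>F. (1 - cmod z) * poisson_kernel z \<zeta>) \<le> C)"
    (is "_ \<longleftrightarrow> (\<exists>C. ?bd C)")
proof -
  let ?S = "SUP \<zeta>\<in>sphere 0 1. SUP F\<in>{F. finite F \<and> F \<subseteq> \<Lambda>}. ennreal (\<Sum>z\<in>F. (1 - cmod z) * poisson_kernel z \<zeta>)"
  have nonneg: "(1 - cmod z) * poisson_kernel z \<zeta> \<ge> 0" if "z \<in> \<Lambda>" for z \<zeta>
    using that assms(1) poisson_kernel_nonneg[of z] by (intro mult_nonneg_nonneg) auto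
  have "(SUP \<zeta>\<in>sphere 0 1. \<Sum>\<^sub>\<infinity>z\<in>\<Lambda>. ennreal ((1 - cmod z) * poisson_kernel z \<zeta>)) = ?S"
  proof (rule SUP_cong[OF refl])
    fix \<zeta> :: complex
    have "(\<Sum>\<^sub>\<infinity>z\<in>\<Lambda>. ennreal ((1 - cmod z) * poisson_kernel z \<zeta>))
        = (SUP F\<in>{F. finite F \<and> F \<subseteq> \<Lambda>}. \<Sum>z\<in>F. ennreal ((1 - cmod z) * poisson_kernel z \<zeta>))"
      by (rule nonneg_infsum_complete) simp
    also have "\<dots> = (SUP F\<in>{F. finite F \<and> F \<subseteq> \<Lambda>}. ennreal (\<Sum>z\<in>F. (1 - cmod z) * poisson_kernel z \<zeta>))"
      by (intro SUP_cong refl sum_ennreal) (use nonneg in auto)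
    finally show "(\<Sum>\<^sub>\<infinity>z\<in>\<Lambda>. ennreal ((1 - cmod z) * poisson_kernel z \<zeta>)) = \<dots>" .
  qed
  then have "bounded_balayage (mu_seq \<Lambda>) \<longleftrightarrow> ?S < \<infinity>"
    by (simp add: bounded_balayage_mu_seq_iff[OF assms])
  also have "\<dots> \<longleftrightarrow> (\<exists>C. ?bd C)"
  proof
    assume fin: "?S < \<infinity>"
    have "?bd (enn2real ?S)"
    proof (intro ballI allI impI)
      fix \<zeta> :: complex and F assume "\<zeta> \<in> sphere 0 1" and F: "finite F \<and> F \<subseteq> \<Lambda>"
      then have "ennreal (\<Sum>z\<in>F. (1 - cmod z) * poisson_kernel z \<zeta>) \<le> ?S"
        by (intro SUP_upper2[of \<zeta>] SUP_upper) auto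
      then have "enn2real (ennreal (\<Sum>z\<in>F. (1 - cmod z) * poisson_kernel z \<zeta>)) \<le> enn2real ?S"
        using fin by (intro enn2real_mono) simp_all
      then show "(\<Sum>z\<in>F. (1 - cmod z) * poisson_kernel z \<zeta>) \<le> enn2real ?S"
        using F nonneg by (subst (asm) enn2real_ennreal) (auto intro!: sum_nonneg)
    qed
    then show "\<exists>C. ?bd C" ..
  next
    assume "\<exists>C. ?bd C"
    then obtain C where "?bd C" ..
    then have "?S \<le> ennreal C"
      by (intro SUP_least ennreal_leI) auto
    then show "?S < \<infinity>"
      by (simp add: order_le_less_trans)
  qed
  finally show ?thesis .
qed

lemma image_scale_cball_subset:
  assumes "0 < r" "r < 1"
  shows "(\<lambda>w. complex_of_real r * w) ` cball 0 1 \<subseteq> ball 0 1"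
proof safe
  fix w :: complex assume "w \<in> cball 0 1"
  then have "r * cmod w \<le> r * 1"
    using assms by (intro mult_left_mono) auto
  then have "r * cmod w < 1"
    using assms by linarith
  then show "of_real r * w \<in> ball 0 1"
    using assms by (simp add: norm_mult)
qed

lemma trace_nevanlinna_subset_l_Ya:
  assumes \<Lambda>: "\<Lambda> \<subseteq> ball 0 1"
    and C: "\<And>\<zeta> F. \<zeta> \<in> sphere 0 1 \<Longrightarrow> finite F \<Longrightarrow> F \<subseteq> \<Lambda> \<Longrightarrow>
      (\<Sum>z\<in>F. (1 - cmod z) * poisson_kernel z \<zeta>) \<le> C"
  shows "trace_space nevanlinna \<Lambda> \<subseteq> l_Ya \<Lambda>"
proof -
  have "(\<lambda>z. (1 - cmod z) * log_plus (cmod (f z))) summable_on \<Lambda>" if f: "f \<in> nevanlinna" for f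
  proof (rule nonneg_bdd_above_summable_on)
    fix z assume "z \<in> \<Lambda>"
    then show "0 \<le> (1 - cmod z) * log_plus (cmod (f z))"
      using \<Lambda> by (intro mult_nonneg_nonneg) auto
  next
    obtain L where hol: "f holomorphic_on ball 0 1" and L: "(log_mean f \<longlongrightarrow> L) (at_left 1)"
      using f by (auto simp: nevanlinna_def)
    have contf: "continuous_on (ball 0 1) f"
      using hol by (rule holomorphic_on_imp_continuous_on)
    show "bdd_above (sum (\<lambda>z. (1 - cmod z) * log_plus (cmod (f z))) ` {F. F \<subseteq> \<Lambda> \<and> finite F})"
    proof (rule bdd_aboveI2)
      fix F assume "F \<in> {F. F \<subseteq> \<Lambda> \<and> finite F}"
      then have F: "F \<subseteq> \<Lambda>" "finite F" by auto
      \<comment> \<open>The constant \<open>C\<close> depends neither on \<open>F\<close> nor on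
        \<open>r\<close>, so the final bound \<open>C * L\<close> is uniform in
        \<open>F\<close>.\<close>
      have le: "(\<Sum>z\<in>F. (1 - cmod z) * log_plus (cmod (f (of_real r * z)))) \<le> C * log_mean f r"
        if r: "0 < r" "r < 1" for r
      proof -
        \<comment> \<open>Unlike \<open>f\<close>, the dilate is continuous on the closed disc, as
          the Poisson bound requires.\<close>
        define g where "g w = f (of_real r * w)" for w
        note img = image_scale_cball_subset[OF r]
        have contg: "continuous_on (cball 0 1) g"
          unfolding g_def by (rule continuous_on_compose2[OF contf _ img]) (intro continuous_intros)
        have holg: "g holomorphic_on ball 0 1"
          unfolding g_def
          by (rule holomorphic_on_compose_gen[OF _ hol order_trans[OF image_mono[OF ball_subset_cball] img], unfolded o_def])
             (intro holomorphic_intros)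
        define v where "v \<theta> = log_plus (cmod (g (cis \<theta>)))" for \<theta>
        have contv: "continuous_on {0..2*pi} v"
          unfolding v_def by (intro continuous_intros continuous_on_compose2[OF contg]) auto
        have int: "(\<lambda>\<theta>. poisson_kernel z (cis \<theta>) * v \<theta>) integrable_on {0..2*pi}" if "z \<in> F" for z
          using that F \<Lambda> by (intro integrable_continuous_real continuous_intros contv) auto
        have "2 * pi * (\<Sum>z\<in>F. (1 - cmod z) * log_plus (cmod (g z)))
            = (\<Sum>z\<in>F. (1 - cmod z) * (2 * pi * log_plus (cmod (g z))))"
          by (simp only: sum_distrib_left mult_ac)
        also have "\<dots> \<le> (\<Sum>z\<in>F. (1 - cmod z) * integral {0..2*pi} (\<lambda>\<theta>. poisson_kernel z (cis \<theta>) * v \<theta>))"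
          unfolding v_def using F \<Lambda>
          by (intro sum_mono mult_left_mono log_plus_le_poisson_integral contg holg) auto
        also have "\<dots> = integral {0..2*pi} (\<lambda>\<theta>. \<Sum>z\<in>F. (1 - cmod z) * (poisson_kernel z (cis \<theta>) * v \<theta>))"
          using F int by (subst integral_sum) (auto intro!: integrable_on_mult_right)
        also have "\<dots> \<le> integral {0..2*pi} (\<lambda>\<theta>. C * v \<theta>)"
        proof (rule integral_le)
          show "(\<lambda>\<theta>. \<Sum>z\<in>F. (1 - cmod z) * (poisson_kernel z (cis \<theta>) * v \<theta>)) integrable_on {0..2*pi}"
            using F int by (intro integrable_sum integrable_on_mult_right) auto
          show "(\<lambda>\<theta>. C * v \<theta>) integrable_on {0..2*pi}"
            by (intro integrable_continuous_real continuous_intros contv)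
          fix \<theta>
          have "(\<Sum>z\<in>F. (1 - cmod z) * poisson_kernel z (cis \<theta>)) * v \<theta> \<le> C * v \<theta>"
            using F by (intro mult_right_mono C) (auto simp: v_def)
          then show "(\<Sum>z\<in>F. (1 - cmod z) * (poisson_kernel z (cis \<theta>) * v \<theta>)) \<le> C * v \<theta>"
            by (simp only: sum_distrib_right mult.assoc)
        qed
        also have "\<dots> = 2 * pi * (C * log_mean f r)"
          by (simp add: log_mean_def v_def g_def)
        finally show ?thesis
          by (simp add: g_def)
      qed
      show "(\<Sum>z\<in>F. (1 - cmod z) * log_plus (cmod (f z))) \<le> C * L"
      \<comment> \<open>With \<open>F\<close> finite and fixed, the left side converges termwise
        because \<open>f\<close> is continuous at the points of \<open>F\<close>.\<close>
      proof (rule tendsto_le[OF trivial_limit_at_left_real])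
        show "((\<lambda>r. C * log_mean f r) \<longlongrightarrow> C * L) (at_left 1)"
          by (intro tendsto_intros L)
        show "((\<lambda>r. \<Sum>z\<in>F. (1 - cmod z) * log_plus (cmod (f (of_real r * z))))
            \<longlongrightarrow> (\<Sum>z\<in>F. (1 - cmod z) * log_plus (cmod (f z)))) (at_left 1)"
        proof (intro tendsto_intros)
          fix z assume "z \<in> F"
          then have "isCont f z"
            using contf F \<Lambda> by (auto simp: continuous_on_eq_continuous_at)
          moreover have "((\<lambda>r. of_real r * z) \<longlongrightarrow> of_real 1 * z) (at_left 1)"
            by (intro tendsto_intros)
          ultimately show "((\<lambda>r. f (of_real r * z)) \<longlongrightarrow> f z) (at_left 1)"
            by (auto intro: isCont_tendsto_compose)
        qed
        show "\<forall>\<^sub>F r in at_left 1. (\<Sum>z\<in>F. (1 - cmod z) * log_plus (cmod (f (of_real r * z)))) \<le> C * log_mean f r"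
          using eventually_at_left_real[OF zero_less_one] by eventually_elim (use le in auto)
      qed
    qed
  qed
  then show ?thesis
    unfolding trace_space_def l_Ya_def by (auto cong: summable_on_cong)
qed


subsection \<open>Smirnov functions with large traces\<close>

text \<open>The conformal map of the disc onto the right half-plane; its real part is the Poisson
  kernel with pole at 1.\<close>

definition cayley :: "complex \<Rightarrow> complex" where
  "cayley w = (1 + w) / (1 - w)"

lemma Re_cayley: "Re (cayley w) = (1 - (cmod w)\<^sup>2) / (cmod (1 - w))\<^sup>2"
proof (cases "w = 1")
  case False
  have "(1 + w) * cnj (1 - w) = of_real (1 - (cmod w)\<^sup>2) + (w - cnj w)"
    using complex_norm_square[of w] by (simp add: algebra_simps)
  then have "Re ((1 + w) * cnj (1 - w)) = 1 - (cmod w)\<^sup>2"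
    by simp
  then show ?thesis
    by (simp only: cayley_def complex_div_cnj[of "1 + w" "1 - w"] Re_divide_of_real
        flip: of_real_power)
\<comment> \<open>At \<open>w = 1\<close> both sides are 0, since division by zero gives 0.\<close>
qed (simp add: cayley_def)

lemma Re_cayley_nonneg: "cmod w \<le> 1 \<Longrightarrow> Re (cayley w) \<ge> 0"
  by (simp add: Re_cayley abs_square_le_1)

text \<open>Multiplication by \<open>cnj \<zeta>\<close> is the rotation that takes the pole
  \<open>\<zeta>\<close> to 1.\<close>

lemma Re_cayley_eq_poisson_kernel:
  assumes "cmod \<zeta> = 1"
  shows "Re (cayley (cnj \<zeta> * z)) = poisson_kernel z \<zeta>"
proof -
  have "cnj \<zeta> * \<zeta> = 1"
    using assms complex_norm_square[of \<zeta>] by (simp add: mult.commute)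
  then have "cnj \<zeta> * (\<zeta> - z) = 1 - cnj \<zeta> * z"
    by (simp add: algebra_simps)
  then have "cmod (1 - cnj \<zeta> * z) = cmod (\<zeta> - z)"
    using assms by (metis complex_mod_cnj mult_1 norm_mult)
  then show ?thesis
    using assms by (simp add: Re_cayley poisson_kernel_def norm_mult)
qed

section \<open>Non-tangential boundary values\<close>

text \<open>The radius ending at \<open>\<zeta>\<close> lies in the Stolz angle of aperture 2.
  Non-triviality of the filter makes the limit in \<open>boundary_value\<close> unique.\<close>

lemma nontangential_neq_bot:
  assumes "cmod \<zeta> = 1"
  shows "nontangential \<zeta> \<noteq> bot"
proof
  assume "nontangential \<zeta> = bot"
  moreover have "at \<zeta> within stolz \<zeta> 2 \<le> nontangential \<zeta>"
    unfolding nontangential_def by (rule SUP_upper) simp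
  ultimately have bot: "at \<zeta> within stolz \<zeta> 2 = bot"
    by (simp add: bot_unique)
  have "((\<lambda>r. of_real r * \<zeta>) \<longlongrightarrow> of_real 1 * \<zeta>) (at_left 1)"
    by (intro tendsto_intros)
  moreover have "\<forall>\<^sub>F r in at_left 1. of_real r * \<zeta> \<in> stolz \<zeta> 2 \<and> of_real r * \<zeta> \<noteq> \<zeta>"
    using eventually_at_left_real[OF zero_less_one]
  proof eventually_elim
    case (elim r)
    have "cmod (of_real r * \<zeta> - \<zeta>) = cmod (of_real (r - 1) * \<zeta>)"
      by (simp add: algebra_simps)
    also have "\<dots> = 1 - r"
      using elim assms by (simp only: norm_mult norm_of_real) simp
    finally have "cmod (of_real r * \<zeta> - \<zeta>) = 1 - r" .
    then show ?case
      using elim assms by (auto simp: stolz_def norm_mult)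
  qed
  ultimately have "filterlim (\<lambda>r. of_real r * \<zeta>) (at \<zeta> within stolz \<zeta> 2) (at_left (1::real))"
    by (simp add: filterlim_at)
  then show False
    unfolding bot by (simp add: filterlim_def bot_unique filtermap_bot_iff)
qed

text \<open>Every Stolz angle lies in the disc and hence in \<open>U\<close>, so continuity relative
  to \<open>U\<close> suffices; \<open>f\<close> may behave badly at boundary points outside
  \<open>U\<close>.\<close>

lemma boundary_value_eq:
  assumes cont: "continuous_on U f" and U: "ball 0 1 \<subseteq> U" "\<zeta> \<in> U" and \<zeta>: "cmod \<zeta> = 1"
  shows "boundary_value f \<zeta> = f \<zeta>"
proof -
  have "(f \<longlongrightarrow> f \<zeta>) (at \<zeta> within U)"
    using cont U by (simp add: continuous_on_def)
  then have "(f \<longlongrightarrow> f \<zeta>) (nontangential \<zeta>)"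
    unfolding tendsto_nontangential_iff
    by (intro allI impI, elim tendsto_within_subset) (use U in \<open>auto simp: stolz_def\<close>)
  then show ?thesis
    unfolding boundary_value_def using nontangential_neq_bot[OF \<zeta>] by (intro tendsto_Lim)
qed

text \<open>\<open>cis\<close> is injective on the half-open period, so only the repeated endpoint
  can add a second solution.\<close>

lemma finite_cis_eq: "finite {\<theta> \<in> {0..2*pi}. l * cis \<theta> = 1}"
proof (rule finite_subset)
  show "{\<theta> \<in> {0..2*pi}. l * cis \<theta> = 1} \<subseteq> {Arg2pi (1 / l), 2 * pi}"
  proof (rule subsetI, rule ccontr)
    fix \<theta> assume "\<theta> \<in> {\<theta> \<in> {0..2*pi}. l * cis \<theta> = 1}" and neq: "\<theta> \<notin> {Arg2pi (1 / l), 2 * pi}"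
    then have \<theta>: "\<theta> \<in> {0..2*pi}" "l * cis \<theta> = 1" "\<theta> \<noteq> 2 * pi"
      by auto
    have "1 / l = cis \<theta>"
      using \<theta>(2) by (metis mult_zero_left nonzero_eq_divide_eq mult.commute zero_neq_one)
    moreover have "Arg2pi (cis \<theta>) = \<theta>"
      by (rule Arg2pi_unique[of 1]) (use \<theta> in \<open>auto simp: cis_conv_exp\<close>)
    ultimately show False
      using neq by simp
  qed
qed simp

section \<open>The series of Cayley kernels and its exponential\<close>

locale cayley_series =
  fixes a :: "nat \<Rightarrow> complex" and l :: complex
  assumes a: "\<And>n. a n \<in> ball 0 1" and lim: "a \<longlonglongrightarrow> l"
begin

text \<open>The weights sum to 1 and \<open>cayley 0 = 1\<close>, which normalises the series to
  \<open>H 0 = 1\<close>.\<close>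

definition summand :: "nat \<Rightarrow> complex \<Rightarrow> complex" where
  "summand n z = (1/2) ^ Suc n * cayley (a n * z)"

definition H :: "complex \<Rightarrow> complex" where
  "H z = (\<Sum>n. summand n z)"

text \<open>The closed disc without the only point at which the poles of the summands, lying outside
  it, can accumulate.\<close>

definition U :: "complex set" where
  "U = {z \<in> cball 0 1. l * z \<noteq> 1}"

lemma norm_l_le: "cmod l \<le> 1"
  using tendsto_norm[OF lim] by (rule LIMSEQ_le_const2) (use a in \<open>auto intro: less_imp_le\<close>)

lemma ball_subset_U: "ball 0 1 \<subseteq> U"
proof
  fix z :: complex assume z: "z \<in> ball 0 1"
  have "cmod (l * z) \<le> 1 * cmod z"
    unfolding norm_mult by (intro mult_right_mono norm_l_le) auto
  then show "z \<in> U"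
    using z by (auto simp: U_def)
qed

lemma norm_a_mult_less: "z \<in> cball 0 1 \<Longrightarrow> cmod (a n * z) < 1"
  using a[of n] mult_left_le[of "cmod z" "cmod (a n)"] by (auto simp: norm_mult)

lemma denom_neq_0: "z \<in> cball 0 1 \<Longrightarrow> 1 - a n * z \<noteq> 0"
  using norm_a_mult_less[of z n] by auto

lemma continuous_on_summand: "continuous_on (cball 0 1) (summand n)"
  unfolding summand_def cayley_def by (intro continuous_intros) (use denom_neq_0 in auto)

lemma holomorphic_on_summand: "summand n holomorphic_on ball 0 1"
  unfolding summand_def cayley_def by (intro holomorphic_intros) (use denom_neq_0 in auto)

lemma Re_summand: "Re (summand n z) = (1/2) ^ Suc n * Re (cayley (a n * z))"
proof -
  have "summand n z = of_real ((1/2) ^ Suc n) * cayley (a n * z)"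
    by (simp add: summand_def)
  then show ?thesis by (simp only: Re_complex_of_real times_complex.sel Im_complex_of_real mult_zero_left diff_zero)
qed

lemma Re_summand_nonneg: "z \<in> cball 0 1 \<Longrightarrow> Re (summand n z) \<ge> 0"
  unfolding Re_summand using norm_a_mult_less[of z n]
  by (intro mult_nonneg_nonneg Re_cayley_nonneg) auto

text \<open>Near a point with \<open>l * z0 \<noteq> 1\<close> the denominators
  \<open>1 - a n * z\<close> stay away from 0 once \<open>a n\<close> is close to \<open>l\<close>,
  so the weights give a geometric majorant for all large \<open>n\<close>.\<close>

lemma uniform_limit_partial_sums:
  assumes z0: "z0 \<in> U"
  obtains d where "d > 0"
    "uniform_limit (cball z0 d \<inter> cball 0 1) (\<lambda>n z. \<Sum>i<n. summand i z) H sequentially"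
proof -
  \<comment> \<open>Replacing \<open>l\<close> by \<open>a n\<close> and \<open>z0\<close> by
    \<open>z\<close> costs at most \<open>c\<close> each, which leaves a denominator of modulus at
    least \<open>2 * c\<close>. As the numerator is at most 2, the kernel is bounded by
    \<open>1 / c\<close>.\<close>
  define c where "c = cmod (1 - l * z0) / 4"
  have c: "c > 0" using z0 by (auto simp: c_def U_def)
  have "\<forall>\<^sub>F n in sequentially. dist (a n) l < c"
    using lim c by (rule tendstoD)
  then have "\<forall>\<^sub>F n in sequentially. \<forall>z\<in>cball z0 c \<inter> cball 0 1.
      norm (summand n z) \<le> (1/2) ^ Suc n * (1 / c)"
  proof eventually_elim
    case (elim n)
    show ?case
    proof
      fix z assume z: "z \<in> cball z0 c \<inter> cball 0 1"
      have "cmod (a n - l) * cmod z \<le> cmod (a n - l) * 1"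
        using z by (intro mult_left_mono) auto
      moreover have "cmod l * cmod (z - z0) \<le> 1 * c"
        using z norm_l_le c by (intro mult_mono) (auto simp: dist_norm norm_minus_commute)
      moreover have "1 - l * z0 = (1 - a n * z) + (a n - l) * z + l * (z - z0)"
        by (simp add: algebra_simps)
      then have "cmod (1 - l * z0) \<le> cmod (1 - a n * z) + cmod ((a n - l) * z) + cmod (l * (z - z0))"
        by (metis add.commute add_left_mono norm_triangle_ineq order_trans)
      ultimately have "2 * c \<le> cmod (1 - a n * z)"
        using elim by (simp add: norm_mult dist_norm c_def)
      moreover have "cmod (1 + a n * z) \<le> 2"
        using norm_triangle_ineq[of 1 "a n * z"] norm_a_mult_less[of z n] z by simp
      ultimately have "cmod (1 + a n * z) / cmod (1 - a n * z) \<le> 2 / (2 * c)"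
        using c by (intro frac_le) auto
      then have "cmod (cayley (a n * z)) \<le> 1 / c"
        by (simp add: cayley_def norm_divide)
      then show "norm (summand n z) \<le> (1/2) ^ Suc n * (1 / c)"
        unfolding summand_def norm_mult norm_power by (intro mult_mono) (auto simp: norm_divide)
    qed
  qed
  moreover have "summable (\<lambda>n. (1/2) ^ Suc n * (1 / c))"
    using power_half_series by (intro summable_mult2) (rule sums_summable)
  ultimately have "uniform_limit (cball z0 c \<inter> cball 0 1) (\<lambda>n z. \<Sum>i<n. summand i z)
      (\<lambda>z. \<Sum>i. summand i z) sequentially"
    by (rule Weierstrass_m_test_ev)
  then show ?thesis
    using c that by (auto simp: H_def[abs_def])
qed

lemma sums_H:
  assumes "z \<in> U"
  shows "(\<lambda>n. summand n z) sums H z"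
proof -
  obtain d where d: "d > 0"
    and lim: "uniform_limit (cball z d \<inter> cball 0 1) (\<lambda>n z. \<Sum>i<n. summand i z) H sequentially"
    using uniform_limit_partial_sums[OF assms] .
  show ?thesis
    unfolding sums_def by (rule tendsto_uniform_limitI[OF lim]) (use d assms in \<open>auto simp: U_def\<close>)
qed

lemma continuous_on_H: "continuous_on U H"
proof -
  have "continuous (at z0 within U) H" if z0: "z0 \<in> U" for z0
  proof -
    obtain d where d: "d > 0"
      and lim: "uniform_limit (cball z0 d \<inter> cball 0 1) (\<lambda>n z. \<Sum>i<n. summand i z) H sequentially"
      using uniform_limit_partial_sums[OF z0] .
    have "continuous_on (cball z0 d \<inter> cball 0 1) H"
      by (rule uniform_limit_theorem[OF _ lim])
         (auto intro!: always_eventually continuous_intros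
            intro: continuous_on_subset[OF continuous_on_summand])
    then have "continuous (at z0 within cball z0 d \<inter> cball 0 1) H"
      using z0 d by (auto simp: continuous_on_eq_continuous_within U_def)
    then have "continuous (at z0 within cball z0 d \<inter> U) H"
      by (rule continuous_within_subset) (auto simp: U_def)
    \<comment> \<open>Continuity within \<open>U\<close> is local, so restricting to a small ball
      around \<open>z0\<close> loses nothing.\<close>
    moreover have "at z0 within cball z0 d \<inter> U = at z0 within U"
      by (rule at_within_nhd[of _ "ball z0 d"]) (use d in auto)
    ultimately show ?thesis by simp
  qed
  then show ?thesis
    by (simp add: continuous_on_eq_continuous_within)
qed

lemma holomorphic_on_H: "H holomorphic_on ball 0 1"
proof (rule holomorphic_uniform_sequence)
  show "(\<lambda>z. \<Sum>i<n. summand i z) holomorphic_on ball 0 1" for n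
    by (intro holomorphic_intros holomorphic_on_summand)
  fix z :: complex assume z: "z \<in> ball 0 1"
  then obtain d where d: "d > 0"
    and lim: "uniform_limit (cball z d \<inter> cball 0 1) (\<lambda>n z. \<Sum>i<n. summand i z) H sequentially"
    using uniform_limit_partial_sums[of z] ball_subset_U by blast
  obtain e where e: "e > 0" "cball z e \<subseteq> ball 0 1"
    using z open_contains_cball open_ball by blast
  have sub: "cball z (min d e) \<subseteq> ball 0 1"
    using e(2) by auto
  then have "cball z (min d e) \<subseteq> cball z d \<inter> cball 0 1"
    by auto
  then show "\<exists>d>0. cball z d \<subseteq> ball 0 1 \<and> uniform_limit (cball z d) (\<lambda>n z. \<Sum>i<n. summand i z) H sequentially"
    using d e sub by (intro exI[of _ "min d e"]) (auto intro: uniform_limit_on_subset[OF lim])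
qed simp

text \<open>All real parts are nonnegative, so one term is dominated by the sum. This carries the
  lower bounds for single kernels over to \<open>H\<close>.\<close>

lemma Re_summand_le_Re_H:
  assumes "z \<in> U"
  shows "Re (summand n z) \<le> Re (H z)"
proof -
  have sums: "(\<lambda>n. Re (summand n z)) sums Re (H z)"
    using sums_H[OF assms] by (rule sums_Re)
  have nonneg: "Re (summand n z) \<ge> 0" for n
    using assms by (intro Re_summand_nonneg) (simp add: U_def)
  show ?thesis
    using sum_le_suminf[OF sums_summable[OF sums], of "{n}"] sums_unique[OF sums] nonneg by simp
qed

lemma Re_H_nonneg: "z \<in> U \<Longrightarrow> Re (H z) \<ge> 0"
  using Re_summand_le_Re_H[of z 0] Re_summand_nonneg[of z 0] by (force simp: U_def)

lemma H_0: "H 0 = 1"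
proof -
  have "(\<lambda>n. of_real ((1/2) ^ Suc n)) sums (of_real 1 :: complex)"
    by (intro sums_of_real power_half_series)
  then have "(\<lambda>n. summand n 0) sums 1"
    by (simp add: summand_def cayley_def)
  then show ?thesis
    by (simp add: H_def sums_iff)
qed

text \<open>Since \<open>Re (H z)\<close> is nonnegative, the positive part in the logarithm has no
  effect.\<close>

lemma log_plus_exp_H: "z \<in> U \<Longrightarrow> log_plus (cmod (exp (H z))) = Re (H z)"
  by (simp add: log_plus_exp Re_H_nonneg)

text \<open>The mean value property of the harmonic function \<open>Re H\<close>, together with
  \<open>H 0 = 1\<close>.\<close>

lemma log_mean_exp_H:
  assumes r: "0 < r" "r < 1"
  shows "log_mean (\<lambda>z. exp (H z)) r = 1"
proof -
  note img = image_scale_cball_subset[OF r]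
  have "((\<lambda>\<theta>. Re (H (of_real r * cis \<theta>))) has_integral 2 * pi * Re (H (of_real r * 0))) {0..2*pi}"
  proof (rule mean_value_Re)
    show "continuous_on (cball 0 1) (\<lambda>w. H (of_real r * w))"
      by (rule continuous_on_compose2[OF continuous_on_H]) (use img ball_subset_U in \<open>auto intro!: continuous_intros\<close>)
    show "(\<lambda>w. H (of_real r * w)) holomorphic_on ball 0 1"
      by (rule holomorphic_on_compose_gen[OF _ holomorphic_on_H
            order_trans[OF image_mono[OF ball_subset_cball] img], unfolded o_def])
         (intro holomorphic_intros)
  qed
  then have "((\<lambda>\<theta>. Re (H (of_real r * cis \<theta>))) has_integral 2 * pi) {0..2*pi}"
    by (simp add: H_0)
  moreover have "log_plus (cmod (exp (H (of_real r * cis \<theta>)))) = Re (H (of_real r * cis \<theta>))" for \<theta>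
    by (intro log_plus_exp_H subsetD[OF ball_subset_U]) (use r in \<open>simp add: norm_mult\<close>)
  ultimately have "((\<lambda>\<theta>. log_plus (cmod (exp (H (of_real r * cis \<theta>))))) has_integral 2 * pi) {0..2*pi}"
    by (simp only:)
  then show ?thesis
    by (simp add: log_mean_def integral_unique del: norm_exp_eq_Re)
qed

text \<open>Each summand has its mean value on the circle, and monotone convergence passes to the
  series without any bound on \<open>H\<close> near the exceptional point.\<close>

lemma has_integral_boundary_exp_H:
  "((\<lambda>\<theta>. log_plus (cmod (boundary_value (\<lambda>z. exp (H z)) (cis \<theta>)))) has_integral 2 * pi) {0..2*pi}"
proof -
  define N where "N = {\<theta> \<in> {0..2*pi}. l * cis \<theta> = 1}"
  have finN: "finite N"
    unfolding N_def by (rule finite_cis_eq)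
  have U: "cis \<theta> \<in> U" if "\<theta> \<in> {0..2*pi} - N" for \<theta>
    using that by (auto simp: N_def U_def)
  \<comment> \<open>The value 0 on the finite set \<open>N\<close> makes the partial sums converge
    at every angle and does not change the integrals.\<close>
  have "((\<lambda>\<theta>. if \<theta> \<in> N then 0 else Re (H (cis \<theta>))) has_integral 2 * pi) {0..2*pi}"
  proof (rule has_integral_monotone_convergence_increasing)
    show "((\<lambda>\<theta>. if \<theta> \<in> N then 0 else \<Sum>i<n. Re (summand i (cis \<theta>))) has_integral
        (\<Sum>i<n. 2 * pi * (1/2) ^ Suc i)) {0..2*pi}" for n
    proof (rule has_integral_spike_finite[OF finN])
      show "((\<lambda>\<theta>. \<Sum>i<n. Re (summand i (cis \<theta>))) has_integral (\<Sum>i<n. 2 * pi * (1/2) ^ Suc i)) {0..2*pi}"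
      proof (rule has_integral_sum)
        fix i
        have "Re (summand i 0) = (1/2) ^ Suc i"
          by (simp add: Re_summand cayley_def)
        then show "((\<lambda>\<theta>. Re (summand i (cis \<theta>))) has_integral 2 * pi * (1/2) ^ Suc i) {0..2*pi}"
          using mean_value_Re[OF continuous_on_summand[of i] holomorphic_on_summand] by (simp only:)
      qed simp
    qed simp
    show "(if \<theta> \<in> N then 0 else \<Sum>i<n. Re (summand i (cis \<theta>)))
        \<le> (if \<theta> \<in> N then 0 else \<Sum>i<Suc n. Re (summand i (cis \<theta>)))" for n \<theta>
      by (simp add: Re_summand_nonneg)
    show "(\<lambda>n. if \<theta> \<in> N then 0 else \<Sum>i<n. Re (summand i (cis \<theta>)))
        \<longlonglongrightarrow> (if \<theta> \<in> N then 0 else Re (H (cis \<theta>)))" if "\<theta> \<in> {0..2*pi}" for \<theta>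
      using sums_Re[OF sums_H[OF U[of \<theta>]]] that by (simp add: sums_def)
    show "(\<lambda>n. \<Sum>i<n. 2 * pi * (1/2) ^ Suc i) \<longlonglongrightarrow> 2 * pi"
      using sums_mult[OF power_half_series, of "2 * pi"] by (simp add: sums_def)
  qed
  then show ?thesis
  proof (rule has_integral_spike_finite[OF finN, rotated])
    fix \<theta> assume \<theta>: "\<theta> \<in> {0..2*pi} - N"
    have "boundary_value (\<lambda>z. exp (H z)) (cis \<theta>) = exp (H (cis \<theta>))"
      using U[OF \<theta>] ball_subset_U
      by (intro boundary_value_eq[of U]) (auto intro!: continuous_intros continuous_on_H)
    then show "log_plus (cmod (boundary_value (\<lambda>z. exp (H z)) (cis \<theta>)))
        = (if \<theta> \<in> N then 0 else Re (H (cis \<theta>)))"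
      using \<theta> by (simp only: log_plus_exp_H[OF U[OF \<theta>]]) simp
  qed
qed

text \<open>The means over the inner circles and the mean of the boundary values all equal
  1.\<close>

lemma exp_H_in_smirnov: "(\<lambda>z. exp (H z)) \<in> smirnov"
proof -
  have "\<forall>\<^sub>F r in at_left 1. 1 = log_mean (\<lambda>z. exp (H z)) r"
    using eventually_at_left_real[OF zero_less_one] by eventually_elim (simp add: log_mean_exp_H)
  then have lim: "(log_mean (\<lambda>z. exp (H z)) \<longlongrightarrow> 1) (at_left 1)"
    by (rule Lim_transform_eventually[OF tendsto_const])
  moreover have "(\<lambda>z. exp (H z)) holomorphic_on ball 0 1"
    by (intro holomorphic_intros holomorphic_on_H)
  ultimately show ?thesis
    using has_integral_boundary_exp_H
    by (auto simp: smirnov_def nevanlinna_def integral_unique integrable_on_def)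
qed

end

section \<open>From unbounded balayage to a trace outside \<open>l_Ya\<close>\<close>

text \<open>A finite sum of Poisson kernels exceeds \<open>M\<close> at some \<open>\<zeta>\<close>.
  The strict inequality survives replacing \<open>cnj \<zeta>\<close> by
  \<open>of_real r * cnj \<zeta>\<close> with \<open>r\<close> close to 1, which moves the pole off
  the closed disc.\<close>

lemma unbounded_balayage_cayley:
  assumes unb: "\<not> (\<exists>C. \<forall>\<zeta>\<in>sphere 0 1. \<forall>F. finite F \<and> F \<subseteq> \<Lambda> \<longrightarrow>
      (\<Sum>z\<in>F. (1 - cmod z) * poisson_kernel z \<zeta>) \<le> C)"
    and \<Lambda>: "\<Lambda> \<subseteq> ball 0 1"
  shows "\<exists>a F. a \<in> ball 0 1 \<and> finite F \<and> F \<subseteq> \<Lambda> \<and> M < (\<Sum>z\<in>F. (1 - cmod z) * Re (cayley (a * z)))"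
proof -
  obtain \<zeta> F where \<zeta>: "cmod \<zeta> = 1" and F: "finite F" "F \<subseteq> \<Lambda>"
    and M: "M < (\<Sum>z\<in>F. (1 - cmod z) * poisson_kernel z \<zeta>)"
    using unb[unfolded not_ex, rule_format, of M] by (auto simp: not_le)
  have neq: "cnj \<zeta> * z \<noteq> 1" if "z \<in> F" for z
  proof
    assume "cnj \<zeta> * z = 1"
    then have "cmod z = 1"
      by (metis \<zeta> complex_mod_cnj mult_1 norm_mult norm_one)
    then show False using that F \<Lambda> by auto
  qed
  have "((\<lambda>r. \<Sum>z\<in>F. (1 - cmod z) * Re (cayley (of_real r * cnj \<zeta> * z)))
      \<longlongrightarrow> (\<Sum>z\<in>F. (1 - cmod z) * Re (cayley (of_real 1 * cnj \<zeta> * z)))) (at_left 1)"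
    unfolding cayley_def by (intro tendsto_intros) (use neq in auto)
  then have "((\<lambda>r. \<Sum>z\<in>F. (1 - cmod z) * Re (cayley (of_real r * cnj \<zeta> * z)))
      \<longlongrightarrow> (\<Sum>z\<in>F. (1 - cmod z) * poisson_kernel z \<zeta>)) (at_left 1)"
    by (simp add: Re_cayley_eq_poisson_kernel \<zeta>)
  then have "\<forall>\<^sub>F r in at_left 1. M < (\<Sum>z\<in>F. (1 - cmod z) * Re (cayley (of_real r * cnj \<zeta> * z)))"
    using M by (rule order_tendstoD)
  then have "\<forall>\<^sub>F r in at_left 1. M < (\<Sum>z\<in>F. (1 - cmod z) * Re (cayley (of_real r * cnj \<zeta> * z)))
      \<and> r \<in> {0<..<1}"
    using eventually_at_left_real[OF zero_less_one] by (rule eventually_conj)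
  then obtain r where "M < (\<Sum>z\<in>F. (1 - cmod z) * Re (cayley (of_real r * cnj \<zeta> * z)))" "r \<in> {0<..<1}"
    using eventually_happens'[OF trivial_limit_at_left_real] by blast
  then show ?thesis
    using F \<zeta> by (intro exI[of _ "of_real r * cnj \<zeta>"] exI[of _ F]) (auto simp: norm_mult)
qed

lemma bounded_balayage_if_trace_smirnov_subset:
  assumes \<Lambda>: "\<Lambda> \<subseteq> ball 0 1" and sub: "trace_space smirnov \<Lambda> \<subseteq> l_Ya \<Lambda>"
  shows "\<exists>C. \<forall>\<zeta>\<in>sphere 0 1. \<forall>F. finite F \<and> F \<subseteq> \<Lambda> \<longrightarrow>
    (\<Sum>z\<in>F. (1 - cmod z) * poisson_kernel z \<zeta>) \<le> C"
proof (rule ccontr)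
  assume unb: "\<not> ?thesis"
  \<comment> \<open>The growth \<open>4 ^ n\<close> outweighs the weight
    \<open>(1/2) ^ Suc n\<close> and leaves \<open>2 ^ n / 2\<close>.\<close>
  have "\<exists>b F. b \<in> ball 0 1 \<and> finite F \<and> F \<subseteq> \<Lambda> \<and> 4 ^ n < (\<Sum>z\<in>F. (1 - cmod z) * Re (cayley (b * z)))" for n :: nat
    by (rule unbounded_balayage_cayley[OF unb \<Lambda>])
  then obtain b F where b: "\<And>n. b n \<in> ball 0 1" and F: "\<And>n. finite (F n)" "\<And>n. F n \<subseteq> \<Lambda>"
    and large: "\<And>n. 4 ^ n < (\<Sum>z\<in>F n. (1 - cmod z) * Re (cayley (b n * z)))"
    by metis
  have "\<forall>n. b n \<in> cball 0 1"
    using b ball_subset_cball by blast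
  then obtain l k where k: "strict_mono k" and lim: "(b \<circ> k) \<longlonglongrightarrow> l"
    using compact_cball[of "0::complex" 1] unfolding compact_def by blast
  interpret cayley_series "b \<circ> k" l
    by unfold_locales (use b lim in auto)
  have "restrict (\<lambda>z. exp (H z)) \<Lambda> \<in> l_Ya \<Lambda>"
    using sub exp_H_in_smirnov by (auto simp: trace_space_def)
  then have "(\<lambda>z. (1 - cmod z) * log_plus (cmod (exp (H z)))) summable_on \<Lambda>"
    by (auto simp: l_Ya_def cong: summable_on_cong)
  also have "?this \<longleftrightarrow> (\<lambda>z. (1 - cmod z) * Re (H z)) summable_on \<Lambda>"
    by (rule summable_on_cong, subst log_plus_exp_H) (use \<Lambda> ball_subset_U in auto)
  finally have summable: "(\<lambda>z. (1 - cmod z) * Re (H z)) summable_on \<Lambda>" .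
  define S where "S = infsum (\<lambda>z. (1 - cmod z) * Re (H z)) \<Lambda>"
  have "2 ^ n < 2 * S" for n :: nat
  proof -
    \<comment> \<open>Passing to the subsequence keeps the lower bound, because
      \<open>n \<le> k n\<close>.\<close>
    have "(4::real) ^ n \<le> 4 ^ k n"
      using k by (intro power_increasing) (auto simp: strict_mono_imp_increasing seq_suble)
    then have "4 ^ n < (\<Sum>z\<in>F (k n). (1 - cmod z) * Re (cayley (b (k n) * z)))"
      using large[of "k n"] by (rule le_less_trans)
    then have "(1/2) ^ Suc n * 4 ^ n < (1/2) ^ Suc n * (\<Sum>z\<in>F (k n). (1 - cmod z) * Re (cayley (b (k n) * z)))"
      by (rule mult_strict_left_mono) simp
    also have "\<dots> = (\<Sum>z\<in>F (k n). (1 - cmod z) * Re (summand n z))"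
      unfolding sum_distrib_left Re_summand by (intro sum.cong) (auto simp: mult_ac)
    also have "\<dots> \<le> (\<Sum>z\<in>F (k n). (1 - cmod z) * Re (H z))"
      using F(2)[of "k n"] \<Lambda> ball_subset_U
      by (intro sum_mono mult_left_mono Re_summand_le_Re_H) auto
    also have "\<dots> \<le> S"
      unfolding S_def using F[of "k n"] \<Lambda> ball_subset_U
      by (intro finite_sum_le_infsum summable mult_nonneg_nonneg Re_H_nonneg) auto
    finally have "(1/2) ^ Suc n * 4 ^ n < S" .
    moreover have "(1/2) ^ Suc n * 4 ^ n = (2::real) ^ n / 2"
      by (simp add: power_divide flip: power_mult_distrib) (simp add: field_simps flip: power_mult_distrib)
    ultimately show ?thesis by simp
  qed
  then show False
    using real_arch_pow[of 2 "2 * S"] by (meson less_asym one_less_numeral_iff semiring_norm(76))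
qed

theorem proposition1p13:
  fixes \<Lambda> :: "complex set"
  assumes "\<Lambda> \<subseteq> ball 0 1"
    and "\<Lambda> sparse_in ball 0 1"
    and "(\<lambda>z. 1 - cmod z) summable_on \<Lambda>"
  shows "(trace_space nevanlinna \<Lambda> \<subseteq> l_Ya \<Lambda> \<longleftrightarrow> trace_space smirnov \<Lambda> \<subseteq> l_Ya \<Lambda>)
    \<and> (trace_space smirnov \<Lambda> \<subseteq> l_Ya \<Lambda> \<longleftrightarrow> bounded_balayage (mu_seq \<Lambda>))"
proof -
  \<comment> \<open>This inclusion gives (a) to (b); the next two facts, (b) to (c) and (c) to (a),
    close the cycle.\<close>
  have "trace_space smirnov \<Lambda> \<subseteq> trace_space nevanlinna \<Lambda>"
    by (auto simp: trace_space_def smirnov_def)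
  moreover have "bounded_balayage (mu_seq \<Lambda>)" if "trace_space smirnov \<Lambda> \<subseteq> l_Ya \<Lambda>"
    unfolding bounded_balayage_mu_seq_iff_finite_sums[OF assms(1,3)]
    by (rule bounded_balayage_if_trace_smirnov_subset[OF assms(1) that])
  moreover have "trace_space nevanlinna \<Lambda> \<subseteq> l_Ya \<Lambda>" if "bounded_balayage (mu_seq \<Lambda>)"
    using that trace_nevanlinna_subset_l_Ya[OF assms(1)]
    unfolding bounded_balayage_mu_seq_iff_finite_sums[OF assms(1,3)] by blast
  ultimately show ?thesis by blast
qed

end
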